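(* For a semigroup $X$ the following conditions are equivalent: (1) $X$ is linear; (2) $\upsilon(X)$ is a band; (3) $\varphi(X)$ is a band; (4) $\lambda(X)$ is a band.
   Context: A semigroup $S$ is linear if $xy\in\{x,y\}$ for all $x,y\in S$; it is a band if $xx=x$ for all $x\in S$. For a set $X$, an upfamily on $X$ is a non-empty family $\mathcal F$ of non-empty subsets of $X$ such that $A\in\mathcal F$ and $A\subset B\subset X$ imply $B\in\mathcal F$; $\upsilon(X)$ is the set of all upfamilies on $X$. For a family $\mathcal B$ of subsets of $X$, $\langle\mathcal B\rangle=\{A\subset X:\exists B\in\mathcal B,\ B\subset A\}$. An upfamily $\mathcal A$ is a filter if $A_1\cap A_2\in\mathcal A$ for all $A_1,A_2\in\mathcal A$; linked if $A\cap B\neq\emptyset$ for all $A,B\in\mathcal A$; maximal linked if it is linked and is not properly contained in another linked upfamily. $\varphi(X)$ and $\lambda(X)$ are the sets of all filters and of all maximal linked upfamilies on $X$, respectively. If $X$ is a semigroup, the operation of $X$ is extended to $\upsilon(X)$ by $\mathcal U*\mathcal V=\big\langle\bigcup_{x\in U}xV_x: U\in\mathcal U,\ (V_x)_{x\in U}\in\mathcal V^U\big\rangle$. This makes $\upsilon(X)$ a semigroup, with $\varphi(X)$ and $\lambda(X)$ as subsemigroups. *)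

theory Defs
  imports "HOL-Library.FuncSet"
begin

text \<open>
  A semigroup is given by a carrier set \<open>S\<close> (possibly empty) and a binary operation \<open>f\<close>
  that is only relevant on \<open>S\<close>; the same predicates are then used for a semigroup \<open>X\<close>
  and for the semigroups of upfamilies on \<open>X\<close>.
\<close>

definition semigroup_on :: "'a set \<Rightarrow> ('a \<Rightarrow> 'a \<Rightarrow> 'a) \<Rightarrow> bool" where
  "semigroup_on S f \<longleftrightarrow>
     (\<forall>x\<in>S. \<forall>y\<in>S. f x y \<in> S) \<and>
     (\<forall>x\<in>S. \<forall>y\<in>S. \<forall>z\<in>S. f (f x y) z = f x (f y z))"

definition linear_semigroup_on :: "'a set \<Rightarrow> ('a \<Rightarrow> 'a \<Rightarrow> 'a) \<Rightarrow> bool" where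
  "linear_semigroup_on S f \<longleftrightarrow> semigroup_on S f \<and> (\<forall>x\<in>S. \<forall>y\<in>S. f x y \<in> {x, y})"

definition band_on :: "'a set \<Rightarrow> ('a \<Rightarrow> 'a \<Rightarrow> 'a) \<Rightarrow> bool" where
  "band_on S f \<longleftrightarrow> semigroup_on S f \<and> (\<forall>x\<in>S. f x x = x)"

definition upfamilies :: "'a set \<Rightarrow> 'a set set set" where
  "upfamilies X = {F. F \<noteq> {} \<and> (\<forall>A\<in>F. A \<noteq> {} \<and> A \<subseteq> X) \<and>
     (\<forall>A B. A \<in> F \<and> A \<subseteq> B \<and> B \<subseteq> X \<longrightarrow> B \<in> F)}"

definition up_closure :: "'a set \<Rightarrow> 'a set set \<Rightarrow> 'a set set" where
  "up_closure X \<B> = {A. A \<subseteq> X \<and> (\<exists>B\<in>\<B>. B \<subseteq> A)}"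

definition filters :: "'a set \<Rightarrow> 'a set set set" where
  "filters X = {F \<in> upfamilies X. \<forall>A\<in>F. \<forall>B\<in>F. A \<inter> B \<in> F}"

definition linked :: "'a set set \<Rightarrow> bool" where
  "linked F \<longleftrightarrow> (\<forall>A\<in>F. \<forall>B\<in>F. A \<inter> B \<noteq> {})"

definition maximal_linked :: "'a set \<Rightarrow> 'a set set set" where
  "maximal_linked X =
     {F \<in> upfamilies X. linked F \<and> \<not> (\<exists>G\<in>upfamilies X. linked G \<and> F \<subset> G)}"

definition upfamily_mult ::
  "'a set \<Rightarrow> ('a \<Rightarrow> 'a \<Rightarrow> 'a) \<Rightarrow> 'a set set \<Rightarrow> 'a set set \<Rightarrow> 'a set set" where
  "upfamily_mult X f \<U> \<V> =
     up_closure X {(\<Union>x\<in>U. f x ` V x) | U V. U \<in> \<U> \<and> V \<in> U \<rightarrow>\<^sub>E \<V>}"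

end

theory Submission
  imports Defs
begin

text \<open>
  Read an upfamily \<open>\<U>\<close> as a quantifier on \<open>X\<close>: ``for \<open>\<U>\<close>-many \<open>x\<close>, \<open>P x\<close>'' means
  \<open>{x \<in> X. P x} \<in> \<U>\<close>. The product is then iteration of quantifiers: \<open>A\<close> belongs to \<open>\<U> * \<V>\<close>
  iff for \<open>\<U>\<close>-many \<open>x\<close>, for \<open>\<V>\<close>-many \<open>y\<close>, \<open>x y \<in> A\<close> (lemma \<open>mem_upfamily_mult\<close>).
  Associativity is immediate from this, and so is closure of the filters and of the maximal linked
  upfamilies: these are the quantifiers that commute with conjunction and with negation,
  respectively.

  If \<open>X\<close> is linear, then every \<open>A \<in> \<U>\<close> satisfies \<open>A A \<subseteq> A\<close>, so \<open>A \<in> \<U> * \<U>\<close>. Conversely, if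
  \<open>A \<in> \<U> * \<U>\<close>, then either all of the \<open>\<U>\<close>-many left factors \<open>x\<close> lie in \<open>A\<close>, or some such \<open>x\<close>
  lies outside \<open>A\<close>; in the second case \<open>x y \<in> A\<close> forces \<open>x y = y \<in> A\<close>. Both cases give
  \<open>A \<in> \<U>\<close>. Hence all upfamilies are idempotent.

  For the converses, few idempotents suffice. Idempotence of the filter of all supersets of
  \<open>{x, y}\<close> forces \<open>{x, y}\<close> to be closed under multiplication. For maximal linked upfamilies,
  the principal ultrafilters show that \<open>X\<close> is a band. If \<open>z = x y\<close> were different from \<open>x\<close>
  and \<open>y\<close>, then the upfamily of sets containing at least two of \<open>x, y, z\<close> is maximal linked and
  contains \<open>{x, y}\<close>, but its square does not: left multiplication by \<open>x\<close> sends both \<open>y\<close> and \<open>z\<close>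
  to \<open>z\<close>, and left multiplication by \<open>z\<close> sends both \<open>y\<close> and \<open>z\<close> to \<open>z\<close>, so that among the
  three points only the left factor \<open>y\<close> can send two of them into \<open>{x, y}\<close>.
\<close>

section \<open>The product as an iterated quantifier\<close>

lemma upfamiliesI:
  assumes "X \<in> \<U>" "{} \<notin> \<U>" "\<And>A. A \<in> \<U> \<Longrightarrow> A \<subseteq> X"
    and "\<And>A B. A \<in> \<U> \<Longrightarrow> A \<subseteq> B \<Longrightarrow> B \<subseteq> X \<Longrightarrow> B \<in> \<U>"
  shows "\<U> \<in> upfamilies X"
  using assms unfolding upfamilies_def by blast

lemma upfamilies_mono:
  "\<lbrakk>\<U> \<in> upfamilies X; A \<in> \<U>; A \<subseteq> B; B \<subseteq> X\<rbrakk> \<Longrightarrow> B \<in> \<U>"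
  unfolding upfamilies_def by blast

lemma upfamilies_subset: "\<lbrakk>\<U> \<in> upfamilies X; A \<in> \<U>\<rbrakk> \<Longrightarrow> A \<subseteq> X"
  unfolding upfamilies_def by blast

lemma upfamilies_carrier: "\<U> \<in> upfamilies X \<Longrightarrow> X \<in> \<U>"
  unfolding upfamilies_def by blast

lemma upfamilies_empty: "\<U> \<in> upfamilies X \<Longrightarrow> {} \<notin> \<U>"
  unfolding upfamilies_def by blast

lemma semigroup_on_closed: "\<lbrakk>semigroup_on X f; x \<in> X; y \<in> X\<rbrakk> \<Longrightarrow> f x y \<in> X"
  unfolding semigroup_on_def by blast

text \<open>
  Given \<open>A\<close>, the largest possible choice of right factors for \<open>x\<close> is \<open>{y \<in> X. f x y \<in> A}\<close>, so a
  union \<open>\<Union>x\<in>U. f x ` V x\<close> inside \<open>A\<close> exists iff these largest sets are in \<open>\<V>\<close> for \<open>\<U>\<close>-many \<open>x\<close>.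
\<close>
lemma mem_upfamily_mult:
  assumes U: "\<U> \<in> upfamilies X" and V: "\<V> \<in> upfamilies X"
  shows "A \<in> upfamily_mult X f \<U> \<V> \<longleftrightarrow>
           A \<subseteq> X \<and> {x \<in> X. {y \<in> X. f x y \<in> A} \<in> \<V>} \<in> \<U>"
proof
  assume "A \<in> upfamily_mult X f \<U> \<V>"
  then obtain U0 V0 where AX: "A \<subseteq> X" and U0: "U0 \<in> \<U>" and V0: "V0 \<in> U0 \<rightarrow>\<^sub>E \<V>"
    and sub: "(\<Union>x\<in>U0. f x ` V0 x) \<subseteq> A"
    unfolding upfamily_mult_def up_closure_def by blast
  have "{y \<in> X. f x y \<in> A} \<in> \<V>" if "x \<in> U0" for x
  proof -
    have "V0 x \<in> \<V>" using V0 that by auto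
    moreover from this have "V0 x \<subseteq> X" using V upfamilies_subset by blast
    moreover from this have "V0 x \<subseteq> {y \<in> X. f x y \<in> A}" using sub that by blast
    ultimately show ?thesis by (blast intro: upfamilies_mono[OF V])
  qed
  then have "U0 \<subseteq> {x \<in> X. {y \<in> X. f x y \<in> A} \<in> \<V>}"
    using upfamilies_subset[OF U U0] by blast
  then show "A \<subseteq> X \<and> {x \<in> X. {y \<in> X. f x y \<in> A} \<in> \<V>} \<in> \<U>"
    using AX upfamilies_mono[OF U U0] by blast
next
  let ?U = "{x \<in> X. {y \<in> X. f x y \<in> A} \<in> \<V>}"
  let ?V = "restrict (\<lambda>x. {y \<in> X. f x y \<in> A}) ?U"
  assume *: "A \<subseteq> X \<and> ?U \<in> \<U>"
  have "?V \<in> ?U \<rightarrow>\<^sub>E \<V>" by auto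
  moreover have "(\<Union>x\<in>?U. f x ` ?V x) \<subseteq> A" by auto
  ultimately show "A \<in> upfamily_mult X f \<U> \<V>"
    using * unfolding upfamily_mult_def up_closure_def by blast
qed

section \<open>Semigroups of upfamilies\<close>

lemma upfamily_mult_closed:
  assumes "semigroup_on X f" and U: "\<U> \<in> upfamilies X" and V: "\<V> \<in> upfamilies X"
  shows "upfamily_mult X f \<U> \<V> \<in> upfamilies X"
proof -
  note mem = mem_upfamily_mult[OF U V, of _ f]
  have "{y \<in> X. f x y \<in> X} = X" if "x \<in> X" for x
    using that semigroup_on_closed[OF assms(1)] by blast
  then have "{x \<in> X. {y \<in> X. f x y \<in> X} \<in> \<V>} = X"
    using upfamilies_carrier[OF V] by auto
  then have "X \<in> upfamily_mult X f \<U> \<V>"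
    using upfamilies_carrier[OF U] by (simp add: mem)
  moreover have "{} \<notin> upfamily_mult X f \<U> \<V>"
    using upfamilies_empty[OF U] upfamilies_empty[OF V] by (simp add: mem)
  moreover have "B \<in> upfamily_mult X f \<U> \<V>"
    if A: "A \<in> upfamily_mult X f \<U> \<V>" and AB: "A \<subseteq> B" and BX: "B \<subseteq> X" for A B
  proof -
    have "{y \<in> X. f x y \<in> B} \<in> \<V>" if "{y \<in> X. f x y \<in> A} \<in> \<V>" for x
      by (rule upfamilies_mono[OF V that]) (use AB in auto)
    then have "{x \<in> X. {y \<in> X. f x y \<in> A} \<in> \<V>} \<subseteq> {x \<in> X. {y \<in> X. f x y \<in> B} \<in> \<V>}"
      by blast
    with A BX show ?thesis
      unfolding mem by (blast intro: upfamilies_mono[OF U])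
  qed
  moreover have "A \<subseteq> X" if "A \<in> upfamily_mult X f \<U> \<V>" for A
    using that mem by blast
  ultimately show ?thesis unfolding upfamilies_def by blast
qed

text \<open>
  Both bracketings say: for \<open>\<U>\<close>-many \<open>x\<close>, for \<open>\<V>\<close>-many \<open>y\<close>, for \<open>\<W>\<close>-many \<open>w\<close>, the product
  of \<open>x, y, w\<close> lies in \<open>A\<close>.
\<close>
lemma upfamily_mult_assoc:
  assumes S: "semigroup_on X f"
    and U: "\<U> \<in> upfamilies X" and V: "\<V> \<in> upfamilies X" and W: "\<W> \<in> upfamilies X"
  shows "upfamily_mult X f (upfamily_mult X f \<U> \<V>) \<W> =
         upfamily_mult X f \<U> (upfamily_mult X f \<V> \<W>)"
proof (rule set_eqI)
  fix A
  note mem = mem_upfamily_mult[OF U V] mem_upfamily_mult[OF V W]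
    mem_upfamily_mult[OF upfamily_mult_closed[OF S U V] W]
    mem_upfamily_mult[OF U upfamily_mult_closed[OF S V W]]
  have assoc: "f (f x y) w = f x (f y w)" if "x \<in> X" "y \<in> X" "w \<in> X" for x y w
    using S that unfolding semigroup_on_def by blast
  have inner: "{y \<in> X. f x y \<in> {z \<in> X. {w \<in> X. f z w \<in> A} \<in> \<W>}} =
               {y \<in> X. {w \<in> X. f y w \<in> {z \<in> X. f x z \<in> A}} \<in> \<W>}" if x: "x \<in> X" for x
  proof -
    have "{w \<in> X. f (f x y) w \<in> A} = {w \<in> X. f y w \<in> {z \<in> X. f x z \<in> A}}" if "y \<in> X" for y
      using x that assoc semigroup_on_closed[OF S] by auto
    then show ?thesis using x semigroup_on_closed[OF S] by auto
  qed
  have "{x \<in> X. {y \<in> X. f x y \<in> {z \<in> X. {w \<in> X. f z w \<in> A} \<in> \<W>}} \<in> \<V>} =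
        {x \<in> X. {z \<in> X. f x z \<in> A} \<in> upfamily_mult X f \<V> \<W>}"
    unfolding mem using inner by auto
  then show "A \<in> upfamily_mult X f (upfamily_mult X f \<U> \<V>) \<W> \<longleftrightarrow>
        A \<in> upfamily_mult X f \<U> (upfamily_mult X f \<V> \<W>)"
    unfolding mem(1,3,4) by auto
qed

lemma semigroup_on_upfamily_subset:
  assumes "semigroup_on X f" and "\<F> \<subseteq> upfamilies X"
    and "\<And>\<U> \<V>. \<U> \<in> \<F> \<Longrightarrow> \<V> \<in> \<F> \<Longrightarrow> upfamily_mult X f \<U> \<V> \<in> \<F>"
  shows "semigroup_on \<F> (upfamily_mult X f)"
  using assms(2,3) upfamily_mult_assoc[OF assms(1)]
  unfolding semigroup_on_def by (simp add: subset_iff)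

lemma filters_subset_upfamilies: "filters X \<subseteq> upfamilies X"
  unfolding filters_def by blast

lemma upfamily_mult_closed_filters:
  assumes S: "semigroup_on X f" and U: "\<U> \<in> filters X" and V: "\<V> \<in> filters X"
  shows "upfamily_mult X f \<U> \<V> \<in> filters X"
proof -
  have U': "\<U> \<in> upfamilies X" and V': "\<V> \<in> upfamilies X"
    using U V filters_subset_upfamilies by auto
  note mem = mem_upfamily_mult[OF U' V', of _ f]
  have "A \<inter> B \<in> upfamily_mult X f \<U> \<V>"
    if A: "A \<in> upfamily_mult X f \<U> \<V>" and B: "B \<in> upfamily_mult X f \<U> \<V>" for A B
  proof -
    have V_int: "{y \<in> X. f x y \<in> A \<inter> B} \<in> \<V>"
      if "{y \<in> X. f x y \<in> A} \<in> \<V>" "{y \<in> X. f x y \<in> B} \<in> \<V>" for x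
    proof -
      have "{y \<in> X. f x y \<in> A} \<inter> {y \<in> X. f x y \<in> B} \<in> \<V>"
        using V that unfolding filters_def by blast
      moreover have "{y \<in> X. f x y \<in> A} \<inter> {y \<in> X. f x y \<in> B} = {y \<in> X. f x y \<in> A \<inter> B}"
        by blast
      ultimately show ?thesis by simp
    qed
    have "{x \<in> X. {y \<in> X. f x y \<in> A} \<in> \<V>} \<inter> {x \<in> X. {y \<in> X. f x y \<in> B} \<in> \<V>} \<in> \<U>"
      using U A B unfolding filters_def mem by blast
    moreover have "{x \<in> X. {y \<in> X. f x y \<in> A} \<in> \<V>} \<inter> {x \<in> X. {y \<in> X. f x y \<in> B} \<in> \<V>}
        \<subseteq> {x \<in> X. {y \<in> X. f x y \<in> A \<inter> B} \<in> \<V>}"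
      using V_int by blast
    ultimately have "{x \<in> X. {y \<in> X. f x y \<in> A \<inter> B} \<in> \<V>} \<in> \<U>"
      by (rule upfamilies_mono[OF U']) blast
    then show ?thesis using A unfolding mem by blast
  qed
  then show ?thesis
    using upfamily_mult_closed[OF S U' V'] unfolding filters_def by blast
qed

section \<open>Maximal linked upfamilies\<close>

text \<open>
  Maximality amounts to deciding every set: a set \<open>A\<close> that meets every member of a linked
  upfamily can be adjoined, together with its supersets, without destroying linkedness, and a
  set that misses some member has its complement in the upfamily.
\<close>
lemma maximal_linked_iff_complement:
  "\<U> \<in> maximal_linked X \<longleftrightarrow>
     \<U> \<in> upfamilies X \<and> linked \<U> \<and> (\<forall>A. A \<subseteq> X \<longrightarrow> A \<in> \<U> \<or> X - A \<in> \<U>)"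
proof
  assume "\<U> \<in> maximal_linked X"
  then have U: "\<U> \<in> upfamilies X" and L: "linked \<U>"
    and M: "\<And>\<G>. \<G> \<in> upfamilies X \<Longrightarrow> linked \<G> \<Longrightarrow> \<not> \<U> \<subset> \<G>"
    unfolding maximal_linked_def by auto
  have "X - A \<in> \<U>" if AX: "A \<subseteq> X" and A: "A \<notin> \<U>" for A
  proof (rule ccontr)
    assume notin: "X - A \<notin> \<U>"
    have meets: "A \<inter> B \<noteq> {}" if B: "B \<in> \<U>" for B
    proof
      assume "A \<inter> B = {}"
      then have "B \<subseteq> X - A" using upfamilies_subset[OF U B] by blast
      then show False using notin upfamilies_mono[OF U B] by blast
    qed
    let ?G = "\<U> \<union> {B. A \<subseteq> B \<and> B \<subseteq> X}"
    have ne: "A \<noteq> {}" using meets[OF upfamilies_carrier[OF U]] by blast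
    have up: "?G \<in> upfamilies X"
    proof (rule upfamiliesI)
      show "X \<in> ?G" using upfamilies_carrier[OF U] by blast
      show "{} \<notin> ?G" using ne upfamilies_empty[OF U] by simp
      show "B \<subseteq> X" if "B \<in> ?G" for B using that upfamilies_subset[OF U] by auto
      show "C \<in> ?G" if "B \<in> ?G" "B \<subseteq> C" "C \<subseteq> X" for B C
      proof (cases "B \<in> \<U>")
        case True
        then show ?thesis using upfamilies_mono[OF U] that(2,3) by simp
      next
        case False
        then show ?thesis using that by auto
      qed
    qed
    have meet_G: "B \<inter> C \<noteq> {}" if BC: "B \<in> ?G" "C \<in> ?G" for B C
    proof -
      consider "B \<in> \<U>" "C \<in> \<U>" | "B \<in> \<U>" "A \<subseteq> C" | "A \<subseteq> B" "C \<in> \<U>" | "A \<subseteq> B" "A \<subseteq> C"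
        using BC by blast
      then show ?thesis
      proof cases
        case 1
        then show ?thesis using L unfolding linked_def by simp
      qed (use meets[of B] meets[of C] ne in blast)+
    qed
    have "linked ?G" unfolding linked_def using meet_G by blast
    moreover have "\<U> \<subset> ?G" using AX A by blast
    ultimately show False using M[OF up] by blast
  qed
  then show "\<U> \<in> upfamilies X \<and> linked \<U> \<and> (\<forall>A. A \<subseteq> X \<longrightarrow> A \<in> \<U> \<or> X - A \<in> \<U>)"
    using U L by blast
next
  assume *: "\<U> \<in> upfamilies X \<and> linked \<U> \<and> (\<forall>A. A \<subseteq> X \<longrightarrow> A \<in> \<U> \<or> X - A \<in> \<U>)"
  have False if G: "\<G> \<in> upfamilies X" "linked \<G>" "\<U> \<subset> \<G>" for \<G>
  proof -
    obtain A where A: "A \<in> \<G>" "A \<notin> \<U>" using G(3) by blast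
    then have "X - A \<in> \<G>" using * upfamilies_subset[OF G(1)] G(3) by blast
    then show False using G(2) A(1) unfolding linked_def by blast
  qed
  then show "\<U> \<in> maximal_linked X" using * unfolding maximal_linked_def by blast
qed

lemma maximal_linked_subset_upfamilies: "maximal_linked X \<subseteq> upfamilies X"
  unfolding maximal_linked_def by blast

lemma maximal_linked_Diff_iff:
  assumes "\<U> \<in> maximal_linked X" "A \<subseteq> X"
  shows "X - A \<in> \<U> \<longleftrightarrow> A \<notin> \<U>"
  using assms unfolding maximal_linked_iff_complement linked_def by blast

lemma upfamily_mult_closed_maximal_linked:
  assumes S: "semigroup_on X f" and U: "\<U> \<in> maximal_linked X" and V: "\<V> \<in> maximal_linked X"
  shows "upfamily_mult X f \<U> \<V> \<in> maximal_linked X"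
proof -
  have U': "\<U> \<in> upfamilies X" and V': "\<V> \<in> upfamilies X"
    using U V maximal_linked_subset_upfamilies by auto
  have L: "linked \<U>" "linked \<V>" using U V unfolding maximal_linked_def by auto
  note mem = mem_upfamily_mult[OF U' V', of _ f]
  have "linked (upfamily_mult X f \<U> \<V>)"
    unfolding linked_def
  proof (intro ballI)
    fix A B
    assume A: "A \<in> upfamily_mult X f \<U> \<V>" and B: "B \<in> upfamily_mult X f \<U> \<V>"
    have "{x \<in> X. {y \<in> X. f x y \<in> A} \<in> \<V>} \<inter> {x \<in> X. {y \<in> X. f x y \<in> B} \<in> \<V>} \<noteq> {}"
      using A B L(1) unfolding mem linked_def by simp
    then obtain x where x: "{y \<in> X. f x y \<in> A} \<in> \<V>" "{y \<in> X. f x y \<in> B} \<in> \<V>"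
      by blast
    then have "{y \<in> X. f x y \<in> A} \<inter> {y \<in> X. f x y \<in> B} \<noteq> {}"
      using L(2) unfolding linked_def by simp
    then obtain y where "f x y \<in> A" "f x y \<in> B" by blast
    then show "A \<inter> B \<noteq> {}" by blast
  qed
  moreover have "X - A \<in> upfamily_mult X f \<U> \<V>"
    if AX: "A \<subseteq> X" and A: "A \<notin> upfamily_mult X f \<U> \<V>" for A
  proof -
    \<comment> \<open>The complement commutes with both quantifiers.\<close>
    have "{y \<in> X. f x y \<in> X - A} \<in> \<V> \<longleftrightarrow> {y \<in> X. f x y \<in> A} \<notin> \<V>" if "x \<in> X" for x
    proof -
      have "{y \<in> X. f x y \<in> X - A} = X - {y \<in> X. f x y \<in> A}"
        using that semigroup_on_closed[OF S] by blast
      then show ?thesis by (simp add: maximal_linked_Diff_iff[OF V])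
    qed
    then have "{x \<in> X. {y \<in> X. f x y \<in> X - A} \<in> \<V>} = X - {x \<in> X. {y \<in> X. f x y \<in> A} \<in> \<V>}"
      by blast
    moreover have "X - {x \<in> X. {y \<in> X. f x y \<in> A} \<in> \<V>} \<in> \<U>"
      using A AX maximal_linked_Diff_iff[OF U, of "{x \<in> X. {y \<in> X. f x y \<in> A} \<in> \<V>}"]
      unfolding mem by blast
    ultimately show ?thesis unfolding mem by simp
  qed
  ultimately show ?thesis
    using upfamily_mult_closed[OF S U' V'] unfolding maximal_linked_iff_complement by blast
qed

lemma principal_ultrafilter_maximal_linked:
  "x \<in> X \<Longrightarrow> {A. A \<subseteq> X \<and> x \<in> A} \<in> maximal_linked X"
  unfolding maximal_linked_iff_complement upfamilies_def linked_def by blast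

text \<open>
  The simplest maximal linked upfamilies that are not ultrafilters. Two majorities among three
  points share a point, and of two complementary sets one holds a majority.
\<close>
lemma majority_maximal_linked:
  assumes "x \<in> X" "y \<in> X" "z \<in> X" "x \<noteq> y" "x \<noteq> z" "y \<noteq> z"
  shows "{A. A \<subseteq> X \<and> (x \<in> A \<and> y \<in> A \<or> x \<in> A \<and> z \<in> A \<or> y \<in> A \<and> z \<in> A)} \<in> maximal_linked X"
    (is "?M \<in> _")
proof -
  have "X \<in> ?M" using assms by blast
  then have "?M \<in> upfamilies X" unfolding upfamilies_def by blast
  moreover have "linked ?M" unfolding linked_def by blast
  moreover have "A \<in> ?M \<or> X - A \<in> ?M" if "A \<subseteq> X" for A using assms that by blast
  ultimately show ?thesis unfolding maximal_linked_iff_complement by blast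
qed

section \<open>Idempotence and linearity\<close>

text \<open>
  An \<open>A \<in> \<U>\<close> is closed under multiplication. If \<open>A \<in> \<U> * \<U>\<close> but \<open>A \<notin> \<U>\<close>, then some admissible
  left factor \<open>x\<close> lies outside \<open>A\<close>, and every \<open>y\<close> with \<open>x y \<in> A\<close> has \<open>x y = y\<close>, so
  \<open>\<U>\<close>-many \<open>y\<close> lie in \<open>A\<close> after all.
\<close>
lemma upfamily_mult_idem:
  assumes lin: "linear_semigroup_on X f" and U: "\<U> \<in> upfamilies X"
  shows "upfamily_mult X f \<U> \<U> = \<U>"
proof (rule set_eqI)
  fix A
  have prod: "f x y = x \<or> f x y = y" if "x \<in> X" "y \<in> X" for x y
    using lin that unfolding linear_semigroup_on_def by blast
  note mem = mem_upfamily_mult[OF U U, of _ f]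
  let ?L = "{x \<in> X. {y \<in> X. f x y \<in> A} \<in> \<U>}"
  show "A \<in> upfamily_mult X f \<U> \<U> \<longleftrightarrow> A \<in> \<U>"
  proof
    assume "A \<in> upfamily_mult X f \<U> \<U>"
    then have AX: "A \<subseteq> X" and L: "?L \<in> \<U>" unfolding mem by auto
    show "A \<in> \<U>"
    proof (cases "?L \<subseteq> A")
      case True
      then show ?thesis using upfamilies_mono[OF U L] AX by blast
    next
      case False
      then obtain x where x: "x \<in> X" "x \<notin> A" and R: "{y \<in> X. f x y \<in> A} \<in> \<U>" by blast
      have "{y \<in> X. f x y \<in> A} \<subseteq> A" using prod[OF x(1)] x(2) by auto metis
      then show ?thesis using upfamilies_mono[OF U R] AX by blast
    qed
  next
    assume A: "A \<in> \<U>"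
    have AX: "A \<subseteq> X" using upfamilies_subset[OF U A] .
    have "{y \<in> X. f x y \<in> A} \<in> \<U>" if "x \<in> A" for x
    proof -
      have "A \<subseteq> {y \<in> X. f x y \<in> A}" using prod that AX by (auto, metis subsetD)
      then show ?thesis using upfamilies_mono[OF U A] by blast
    qed
    then have "A \<subseteq> ?L" using AX by blast
    then have "?L \<in> \<U>" using upfamilies_mono[OF U A] by blast
    then show "A \<in> upfamily_mult X f \<U> \<U>" using AX unfolding mem by blast
  qed
qed

lemma supersets_filter:
  "\<lbrakk>B \<subseteq> X; B \<noteq> {}\<rbrakk> \<Longrightarrow> {A. A \<subseteq> X \<and> B \<subseteq> A} \<in> filters X"
  unfolding filters_def upfamilies_def by blast

text \<open>
  The square of the filter of supersets of \<open>{x, y}\<close> contains \<open>{x, y}\<close> only if \<open>{x, y}\<close> is closed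
  under multiplication.
\<close>
lemma idem_filters_linear:
  assumes S: "semigroup_on X f"
    and idem: "\<And>\<U>. \<U> \<in> filters X \<Longrightarrow> upfamily_mult X f \<U> \<U> = \<U>"
  shows "linear_semigroup_on X f"
proof -
  have "f x y \<in> {x, y}" if x: "x \<in> X" and y: "y \<in> X" for x y
  proof -
    let ?F = "{A. A \<subseteq> X \<and> {x, y} \<subseteq> A}"
    have F: "?F \<in> filters X" using supersets_filter[of "{x, y}" X] x y by simp
    then have F': "?F \<in> upfamilies X" using filters_subset_upfamilies by blast
    have "{x, y} \<in> upfamily_mult X f ?F ?F"
      unfolding idem[OF F] using x y by simp
    then show ?thesis
      unfolding mem_upfamily_mult[OF F' F'] by blast
  qed
  then show ?thesis using S unfolding linear_semigroup_on_def by blast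
qed

text \<open>
  Principal ultrafilters give \<open>x x = x\<close>. For \<open>z = x y\<close> this yields \<open>x z = z\<close> and \<open>z y = z z = z\<close>;
  were \<open>z\<close> different from \<open>x\<close> and \<open>y\<close>, the square of the majority upfamily of \<open>x, y, z\<close> would
  lack \<open>{x, y}\<close>, since neither \<open>x\<close> nor \<open>z\<close> is an admissible left factor.
\<close>
lemma idem_maximal_linked_linear:
  assumes S: "semigroup_on X f"
    and idem: "\<And>\<U>. \<U> \<in> maximal_linked X \<Longrightarrow> upfamily_mult X f \<U> \<U> = \<U>"
  shows "linear_semigroup_on X f"
proof -
  have sq: "f x x = x" if x: "x \<in> X" for x
  proof -
    let ?P = "{A. A \<subseteq> X \<and> x \<in> A}"
    have P: "?P \<in> maximal_linked X" using principal_ultrafilter_maximal_linked[OF x] .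
    then have P': "?P \<in> upfamilies X" using maximal_linked_subset_upfamilies by blast
    have "{x} \<in> upfamily_mult X f ?P ?P" unfolding idem[OF P] using x by simp
    then show ?thesis unfolding mem_upfamily_mult[OF P' P'] by blast
  qed
  have "f x y \<in> {x, y}" if x: "x \<in> X" and y: "y \<in> X" for x y
  proof (rule ccontr)
    define z where "z = f x y"
    assume "f x y \<notin> {x, y}"
    then have ne: "x \<noteq> z" "y \<noteq> z" "x \<noteq> y" using sq[OF x] unfolding z_def by auto
    have z: "z \<in> X" unfolding z_def using semigroup_on_closed[OF S x y] .
    have "f x z = f (f x x) y" and "f z y = f x (f y y)"
      using S x y unfolding semigroup_on_def z_def by simp_all
    then have prods: "f x y = z" "f x z = z" "f z y = z" "f z z = z"
      using sq x y z z_def by simp_all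
    let ?M = "{A. A \<subseteq> X \<and> (x \<in> A \<and> y \<in> A \<or> x \<in> A \<and> z \<in> A \<or> y \<in> A \<and> z \<in> A)}"
    have M: "?M \<in> maximal_linked X"
      using majority_maximal_linked[OF x y z ne(3) ne(1) ne(2)] .
    then have M': "?M \<in> upfamilies X" using maximal_linked_subset_upfamilies by blast
    have "{x, y} \<in> upfamily_mult X f ?M ?M" unfolding idem[OF M] using x y by simp
    then have "{u \<in> X. {w \<in> X. f u w \<in> {x, y}} \<in> ?M} \<in> ?M"
      unfolding mem_upfamily_mult[OF M' M'] by (rule conjunct2)
    then show False using prods ne by (simp add: ne[symmetric])
  qed
  then show ?thesis using S unfolding linear_semigroup_on_def by blast
qed

theorem theorem1p1:
  fixes X :: "'a set" and f :: "'a \<Rightarrow> 'a \<Rightarrow> 'a"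
  assumes "semigroup_on X f"
  shows "(linear_semigroup_on X f \<longleftrightarrow> band_on (upfamilies X) (upfamily_mult X f)) \<and>
         (linear_semigroup_on X f \<longleftrightarrow> band_on (filters X) (upfamily_mult X f)) \<and>
         (linear_semigroup_on X f \<longleftrightarrow> band_on (maximal_linked X) (upfamily_mult X f))"
proof -
  let ?m = "upfamily_mult X f"
  have semi: "semigroup_on (upfamilies X) ?m" "semigroup_on (filters X) ?m"
      "semigroup_on (maximal_linked X) ?m"
    by (intro semigroup_on_upfamily_subset assms order_refl filters_subset_upfamilies
        maximal_linked_subset_upfamilies upfamily_mult_closed upfamily_mult_closed_filters
        upfamily_mult_closed_maximal_linked; assumption)+
  have band: "band_on \<F> ?m"
    if "linear_semigroup_on X f" "\<F> \<subseteq> upfamilies X" "semigroup_on \<F> ?m" for \<F>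
    using that upfamily_mult_idem unfolding band_on_def by blast
  have "linear_semigroup_on X f" if "band_on (filters X) ?m"
    using that idem_filters_linear[OF assms] unfolding band_on_def by blast
  moreover have "band_on (filters X) ?m" if "band_on (upfamilies X) ?m"
    using that semi(2) filters_subset_upfamilies unfolding band_on_def by blast
  moreover have "linear_semigroup_on X f" if "band_on (maximal_linked X) ?m"
    using that idem_maximal_linked_linear[OF assms] unfolding band_on_def by blast
  ultimately show ?thesis
    using band semi filters_subset_upfamilies maximal_linked_subset_upfamilies by blast
qed

end
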